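(* Let $k$ be a positive integer and let $T$ be a tree. If $|F(T)|>k\,(M(T)+2)$, then $\mu_{\mathrm{int}}(\widetilde{T})>k$.
   Context: Graphs are finite and simple. A $k$-improper edge coloring of a graph $H$ is a map $\alpha:E(H)\to\mathbb{N}$ such that at most $k$ edges with a common endpoint receive the same color; it is an improper interval coloring if at every vertex the colors on incident edges form a set of consecutive integers. $\mu_{\mathrm{int}}(H)$ is the smallest $k$ such that $H$ has a $k$-improper interval edge coloring. For a tree $T$, $F(T)=\{v\in V(T): d_T(v)=1\}$ is its set of leaves, and, with $\mathcal{P}$ the set of all paths in $T$, $$M(T)=\max_{P\in\mathcal{P}}\Big(|E(P)|+\big|\{uw\in E(T): u\in V(P),\ w\notin V(P)\}\big|\Big).$$ The graph $\widetilde{T}$ is obtained from $T$ by adding a new vertex $u$ and the edges $uv$ for all $v\in F(T)$. *)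

theory Defs
  imports Main
begin

record 'a ugraph =
  verts :: "'a set"
  edges :: "'a set set"

definition simple_graph :: "'a ugraph \<Rightarrow> bool" where
  "simple_graph G \<longleftrightarrow> finite (verts G) \<and>
     (\<forall>e\<in>edges G. \<exists>u\<in>verts G. \<exists>v\<in>verts G. u \<noteq> v \<and> e = {u, v})"

definition incident_edges :: "'a ugraph \<Rightarrow> 'a \<Rightarrow> 'a set set" where
  "incident_edges G v = {e \<in> edges G. v \<in> e}"

definition degree :: "'a ugraph \<Rightarrow> 'a \<Rightarrow> nat" where
  "degree G v = card (incident_edges G v)"

definition walk :: "'a ugraph \<Rightarrow> 'a list \<Rightarrow> bool" where
  "walk G p \<longleftrightarrow> p \<noteq> [] \<and> set p \<subseteq> verts G \<and>
     (\<forall>i. Suc i < length p \<longrightarrow> {p ! i, p ! Suc i} \<in> edges G)"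

text \<open>A path is given by one of its two vertex sequences; the one-vertex path is included.\<close>

definition path :: "'a ugraph \<Rightarrow> 'a list \<Rightarrow> bool" where
  "path G p \<longleftrightarrow> walk G p \<and> distinct p"

definition path_edges :: "'a list \<Rightarrow> 'a set set" where
  "path_edges p = {{p ! i, p ! Suc i} | i. Suc i < length p}"

definition cycle :: "'a ugraph \<Rightarrow> 'a list \<Rightarrow> bool" where
  "cycle G p \<longleftrightarrow> path G p \<and> length p \<ge> 3 \<and> {last p, hd p} \<in> edges G"

definition connected_graph :: "'a ugraph \<Rightarrow> bool" where
  "connected_graph G \<longleftrightarrow> verts G \<noteq> {} \<and>
     (\<forall>u\<in>verts G. \<forall>v\<in>verts G. \<exists>p. walk G p \<and> hd p = u \<and> last p = v)"

definition tree :: "'a ugraph \<Rightarrow> bool" where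
  "tree T \<longleftrightarrow> simple_graph T \<and> connected_graph T \<and> (\<nexists>p. cycle T p)"

definition leaves :: "'a ugraph \<Rightarrow> 'a set" where
  "leaves T = {v \<in> verts T. degree T v = 1}"

definition boundary_edges :: "'a ugraph \<Rightarrow> 'a set \<Rightarrow> 'a set set" where
  "boundary_edges G S = {{u, w} | u w. {u, w} \<in> edges G \<and> u \<in> S \<and> w \<notin> S}"

definition path_max :: "'a ugraph \<Rightarrow> nat" where
  "path_max T =
     Max ((\<lambda>p. card (path_edges p) + card (boundary_edges T (set p))) ` {p. path T p})"

text \<open>The new vertex is \<open>None\<close>; the old vertices are embedded by \<open>Some\<close>.\<close>

definition leaf_cone :: "'a ugraph \<Rightarrow> 'a option ugraph" where
  "leaf_cone T =
     \<lparr>verts = insert None (Some ` verts T),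
      edges = (\<lambda>e. Some ` e) ` edges T \<union> {{None, Some v} | v. v \<in> leaves T}\<rparr>"

definition improper_edge_coloring :: "nat \<Rightarrow> 'a ugraph \<Rightarrow> ('a set \<Rightarrow> nat) \<Rightarrow> bool" where
  "improper_edge_coloring k G \<alpha> \<longleftrightarrow>
     (\<forall>v\<in>verts G. \<forall>c. card {e \<in> incident_edges G v. \<alpha> e = c} \<le> k)"

text \<open>The set of colors at an isolated vertex is empty, which is the case \<open>b < a\<close> below.\<close>

definition interval_coloring :: "'a ugraph \<Rightarrow> ('a set \<Rightarrow> nat) \<Rightarrow> bool" where
  "interval_coloring G \<alpha> \<longleftrightarrow>
     (\<forall>v\<in>verts G. \<exists>a b. \<alpha> ` incident_edges G v = {a..b})"

definition mu_int :: "'a ugraph \<Rightarrow> nat" where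
  "mu_int G =
     (LEAST k. \<exists>\<alpha>. improper_edge_coloring k G \<alpha> \<and> interval_coloring G \<alpha>)"

lemma finite_edges:
  assumes "simple_graph G"
  shows "finite (edges G)"
proof (rule finite_subset)
  show "edges G \<subseteq> Pow (verts G)"
    using assms unfolding simple_graph_def by fastforce
  show "finite (Pow (verts G))"
    using assms unfolding simple_graph_def by simp
qed

text \<open>The minimum in \<open>mu_int\<close> and the maximum in \<open>path_max\<close> exist.\<close>

lemma ex_improper_interval_coloring:
  assumes "simple_graph G"
  shows "\<exists>k \<alpha>. improper_edge_coloring k G \<alpha> \<and> interval_coloring G \<alpha>"
proof (intro exI conjI)
  show "improper_edge_coloring (card (edges G)) G (\<lambda>_. 0)"
    unfolding improper_edge_coloring_def incident_edges_def
    by (intro ballI allI card_mono finite_edges[OF assms]) blast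
  have "\<exists>a b. (\<lambda>_. 0::nat) ` A = {a..b}" for A :: "'a set set"
  proof (cases "A = {}")
    case True
    then have "(\<lambda>_. 0::nat) ` A = {1..0}" by simp
    then show ?thesis by blast
  next
    case False
    then have "(\<lambda>_. 0::nat) ` A = {0..0}" by auto
    then show ?thesis by blast
  qed
  then show "interval_coloring G (\<lambda>_. 0)"
    unfolding interval_coloring_def by blast
qed

lemma finite_paths:
  assumes "simple_graph G"
  shows "finite {p. path G p}"
proof (rule finite_subset)
  have fin: "finite (verts G)" using assms unfolding simple_graph_def by simp
  show "{p. path G p} \<subseteq> {p. set p \<subseteq> verts G \<and> length p \<le> card (verts G)}"
  proof clarify
    fix p assume "path G p"
    then have p: "set p \<subseteq> verts G" "distinct p" unfolding path_def walk_def by auto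
    have "length p = card (set p)" using distinct_card[OF p(2)] by simp
    also have "\<dots> \<le> card (verts G)" using card_mono[OF fin p(1)] .
    finally show "set p \<subseteq> verts G \<and> length p \<le> card (verts G)" using p(1) by blast
  qed
  show "finite {p. set p \<subseteq> verts G \<and> length p \<le> card (verts G)}"
    by (rule finite_lists_length_le[OF fin])
qed

lemma ex_path:
  assumes "verts G \<noteq> {}"
  shows "{p. path G p} \<noteq> {}"
proof -
  obtain v where "v \<in> verts G" using assms by blast
  then have "path G [v]" unfolding path_def walk_def by simp
  then show ?thesis by blast
qed

lemma simple_graph_leaf_cone:
  assumes "simple_graph T"
  shows "simple_graph (leaf_cone T)"
  unfolding simple_graph_def
proof (intro conjI ballI)
  show "finite (verts (leaf_cone T))"
    using assms unfolding simple_graph_def leaf_cone_def by simp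
next
  fix e assume "e \<in> edges (leaf_cone T)"
  then consider e' where "e' \<in> edges T" "e = Some ` e'"
    | v where "v \<in> leaves T" "e = {None, Some v}"
    unfolding leaf_cone_def by auto
  then show "\<exists>u\<in>verts (leaf_cone T). \<exists>v\<in>verts (leaf_cone T). u \<noteq> v \<and> e = {u, v}"
  proof cases
    case 1
    then obtain u v where uv: "u \<in> verts T" "v \<in> verts T" "u \<noteq> v" "e' = {u, v}"
      using assms unfolding simple_graph_def by blast
    then have "Some u \<in> verts (leaf_cone T)" "Some v \<in> verts (leaf_cone T)"
      "Some u \<noteq> Some v" "e = {Some u, Some v}"
      using 1 unfolding leaf_cone_def by auto
    then show ?thesis by blast
  next
    case 2
    then have "None \<in> verts (leaf_cone T)" "Some v \<in> verts (leaf_cone T)"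
      unfolding leaf_cone_def leaves_def by auto
    then show ?thesis using 2 by blast
  qed
qed

end

(* In a k-improper interval coloring of the cone the apex sees at least |F(T)|/k colors, which form
   an interval. Close the path of T joining the leaves of the smallest and the largest of these
   colors through the apex. Consecutive edges of an interval coloring meeting at v differ in color
   by at most d(v) - 1, so the difference of the two extreme colors is at most the sum of d(v) - 1
   along the path. As paths of a tree are induced, this sum is at most M(T) - 1, plus 1 for each of
   the two end vertices. *)

theory Submission
  imports Defs
begin

section \<open>Walks and paths as vertex lists\<close>

lemma walk_iff_successively:
  "walk G p \<longleftrightarrow> p \<noteq> [] \<and> set p \<subseteq> verts G \<and> successively (\<lambda>x y. {x, y} \<in> edges G) p"
  unfolding walk_def successively_conv_nth ..

lemma walk_Cons_Cons:
  "walk G (x # y # p) \<longleftrightarrow> x \<in> verts G \<and> {x, y} \<in> edges G \<and> walk G (y # p)"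
  by (auto simp: walk_iff_successively)

lemma walk_append:
  assumes "p \<noteq> []" "q \<noteq> []"
  shows "walk G (p @ q) \<longleftrightarrow> walk G p \<and> walk G q \<and> {last p, hd q} \<in> edges G"
  using assms by (auto simp: walk_iff_successively successively_append_iff)

lemma path_Cons_Cons:
  "path G (x # y # p) \<longleftrightarrow>
     x \<in> verts G \<and> {x, y} \<in> edges G \<and> x \<notin> set (y # p) \<and> path G (y # p)"
  unfolding path_def walk_Cons_Cons by auto

lemma path_append:
  assumes "path G (p @ q)"
  shows "p \<noteq> [] \<Longrightarrow> path G p" and "q \<noteq> [] \<Longrightarrow> path G q"
  using assms walk_append[of p q G] unfolding path_def by (cases "p = []"; cases "q = []"; auto)+

lemma path_edges_Cons_Cons: "path_edges (x # y # p) = insert {x, y} (path_edges (y # p))"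
proof -
  have "{i. Suc i < length (x # y # p)} = insert 0 (Suc ` {i. Suc i < length (y # p)})"
    by (auto simp: image_iff gr0_conv_Suc less_Suc_eq_0_disj)
  moreover have "path_edges q = (\<lambda>i. {q ! i, q ! Suc i}) ` {i. Suc i < length q}" for q :: "'a list"
    unfolding path_edges_def by blast
  ultimately show ?thesis by (simp add: image_image)
qed

lemma walk_imp_path:
  assumes "walk G p"
  obtains q where "path G q" "hd q = hd p" "last q = last p"
  using assms
proof (induction p arbitrary: thesis rule: induct_list012)
  case 1
  then show ?case by (simp add: walk_def)
next
  case (2 x)
  then show ?case by (metis distinct_singleton path_def)
next
  case (3 x y p)
  then obtain q where q: "path G q" "hd q = y" "last q = last (y # p)"
    by (metis walk_Cons_Cons list.sel(1))
  then obtain q' where [simp]: "q = y # q'"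
    unfolding path_def walk_def by (metis list.collapse)
  show ?case
  proof (cases "x \<in> set q")
    case True
    \<comment> \<open>When \<open>x\<close> already lies on \<open>q\<close>, dropping everything
      before it leaves a path that starts at \<open>x\<close> and has the same end.\<close>
    then obtain us vs where us: "q = us @ x # vs" by (meson split_list)
    have "path G (x # vs)"
      using q(1) path_append(2)[of G us "x # vs"] unfolding us by simp
    moreover have "last (x # vs) = last (y # p)"
      using q(3) unfolding us by simp
    ultimately show ?thesis using 3(3)[of "x # vs"] by simp
  next
    case False
    then have "path G (x # q)"
      using q 3(4) by (auto simp: path_Cons_Cons walk_Cons_Cons)
    then show ?thesis using 3(3)[of "x # q"] q by simp
  qed
qed

section \<open>Edges meeting a path in an acyclic graph\<close>

lemma finite_incident_edges: "simple_graph G \<Longrightarrow> finite (incident_edges G v)"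
  by (simp add: incident_edges_def finite_edges)

text \<open>Otherwise the segment of the path from \<open>x\<close> to \<open>z\<close>, which has
  at least three vertices, closes up to a cycle through the edge \<open>{x, z}\<close>.\<close>

lemma path_no_chord:
  assumes "\<nexists>c. cycle G c" "path G (x # y # p)" "z \<in> set (x # y # p)" "{x, z} \<in> edges G" "x \<noteq> z"
  shows "z = y"
proof (rule ccontr)
  assume "z \<noteq> y"
  then obtain us vs where "p = us @ z # vs" using assms by (metis set_ConsD split_list)
  then have "path G (x # y # us @ [z])"
    using assms(2) path_append(1)[of G "x # y # us @ [z]" vs] by simp
  then have "cycle G (x # y # us @ [z])"
    using assms(4) unfolding cycle_def by (simp add: insert_commute)
  then show False using assms(1) by blast
qed

text \<open>Peel off the first vertex \<open>x\<close>: without chords, an edge at \<open>x\<close>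
  can only lead to the second vertex, and any other edge lies within the rest of the path.\<close>

lemma edges_on_path:
  assumes "simple_graph G" "\<nexists>c. cycle G c" "path G p" "e \<in> edges G" "e \<subseteq> set p"
  shows "e \<in> path_edges p"
  using assms(3,5)
proof (induction p rule: induct_list012)
  case 1
  then show ?case by (simp add: path_def walk_def)
next
  case (2 x)
  then show ?case using assms(1,4) unfolding simple_graph_def by fastforce
next
  case (3 x y p)
  show ?case
  proof (cases "x \<in> e")
    case True
    then obtain z where "e = {x, z}" "x \<noteq> z"
      using assms(1,4) unfolding simple_graph_def by fastforce
    with 3 assms(4) have "z = y"
      using path_no_chord[OF assms(2), of x y p z] by auto
    then show ?thesis using \<open>e = {x, z}\<close> by (simp add: path_edges_Cons_Cons)
  next
    case False
    then show ?thesis using 3 by (auto simp: path_edges_Cons_Cons path_Cons_Cons)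
  qed
qed

text \<open>An edge touching the path has either both ends on it, and is then a path edge, or
  exactly one, and is then a boundary edge. These two kinds are what \<open>path_max\<close>
  counts.\<close>

lemma card_incident_le_path_max:
  assumes "simple_graph G" "\<nexists>c. cycle G c" "path G p"
  shows "card (\<Union>v\<in>set p. incident_edges G v) \<le> path_max G"
proof -
  have "(\<Union>v\<in>set p. incident_edges G v) \<subseteq> path_edges p \<union> boundary_edges G (set p)"
  proof
    fix e assume "e \<in> (\<Union>v\<in>set p. incident_edges G v)"
    then obtain v where v: "v \<in> set p" "v \<in> e" "e \<in> edges G"
      by (auto simp: incident_edges_def)
    then obtain w where e: "e = {v, w}"
      using assms(1) unfolding simple_graph_def by fastforce
    show "e \<in> path_edges p \<union> boundary_edges G (set p)"
      using edges_on_path[OF assms v(3)] v e unfolding boundary_edges_def by auto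
  qed
  moreover have "finite (path_edges p)"
    unfolding path_edges_def
    by (rule finite_image_set, rule finite_subset[of _ "{..<length p}"]) auto
  moreover have "finite (boundary_edges G (set p))"
    by (rule finite_subset[OF _ finite_edges[OF assms(1)]]) (auto simp: boundary_edges_def)
  ultimately have "card (\<Union>v\<in>set p. incident_edges G v)
      \<le> card (path_edges p) + card (boundary_edges G (set p))"
    by (meson card_Un_le card_mono finite_UnI le_trans)
  also have "\<dots> \<le> path_max G"
    unfolding path_max_def using assms(3) finite_paths[OF assms(1)] by (intro Max_ge) auto
  finally show ?thesis .
qed

text \<open>A vertex \<open>x\<close> put in front of the path shares only the edge
  \<open>{x, y}\<close> with what follows, so it adds at least its degree minus 1 to the union. The
  last vertex contributes its full degree, which makes the inequality strict; a positive degree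
  there excludes the truncated case \<open>0 - 1 = 0\<close>.\<close>

lemma sum_degree_path:
  assumes "simple_graph G" "\<nexists>c. cycle G c" "path G p" "degree G (last p) > 0"
  shows "(\<Sum>v\<in>set p. degree G v - 1) < card (\<Union>v\<in>set p. incident_edges G v)"
  using assms(3,4)
proof (induction p rule: induct_list012)
  case 1
  then show ?case by (simp add: path_def walk_def)
next
  case (2 x)
  then show ?case by (simp add: degree_def)
next
  case (3 x y p)
  let ?I = "\<Union>v\<in>set (y # p). incident_edges G v"
  have x: "x \<notin> set (y # p)" and p: "path G (y # p)"
    using 3 by (simp_all add: path_Cons_Cons)
  have fin: "finite (incident_edges G x)" "finite ?I"
    using finite_incident_edges[OF assms(1)] by blast+
  have "incident_edges G x \<inter> ?I \<subseteq> {{x, y}}"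
  proof
    fix e assume "e \<in> incident_edges G x \<inter> ?I"
    then obtain z where z: "z \<in> set (y # p)" "z \<in> e" "x \<in> e" "e \<in> edges G"
      by (auto simp: incident_edges_def)
    moreover have "x \<noteq> z" using x z(1) by blast
    ultimately have e: "e = {x, z}"
      using assms(1) unfolding simple_graph_def by fastforce
    have "z = y"
      using path_no_chord[OF assms(2) 3(3), of z] z e \<open>x \<noteq> z\<close> by auto
    then show "e \<in> {{x, y}}" using e by simp
  qed
  then have "card (incident_edges G x \<inter> ?I) \<le> 1"
    using card_mono[of "{{x, y}}"] by fastforce
  \<comment> \<open>Inclusion-exclusion. Bounding the intersection by the degree of \<open>x\<close>
    as well covers truncated subtraction at degree 0.\<close>
  then have "degree G x - 1 + card ?I \<le> card (incident_edges G x \<union> ?I)"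
    using card_Un_Int[OF fin] card_mono[OF fin(1), of "incident_edges G x \<inter> ?I"]
    unfolding degree_def by simp
  moreover have "(\<Sum>v\<in>set (y # p). degree G v - 1) < card ?I"
    using 3 p by simp
  moreover have "(\<Sum>v\<in>set (x # y # p). degree G v - 1)
      = degree G x - 1 + (\<Sum>v\<in>set (y # p). degree G v - 1)"
    using sum.insert[OF finite_set x, of "\<lambda>v. degree G v - 1"] by simp
  ultimately show ?case by (simp only: list.set(2)[of x] UN_insert)
qed

text \<open>An inner vertex already has degree at least 2 from its two path edges.\<close>

lemma leaf_on_path:
  assumes "simple_graph G" "path G p" "v \<in> set p" "v \<in> leaves G"
  shows "v = hd p \<or> v = last p"
proof (rule ccontr)
  assume v: "\<not> (v = hd p \<or> v = last p)"
  obtain us vs where p: "p = us @ v # vs" using assms(3) by (meson split_list)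
  moreover from this v obtain us' a where us: "us = us' @ [a]" by (cases us rule: rev_cases) auto
  moreover from p v obtain b vs' where vs: "vs = b # vs'" by (cases vs) auto
  ultimately have "path G (a # v # b # vs')"
    using assms(2) path_append(2)[of G us' "a # v # b # vs'"] by simp
  then have "{a, v} \<noteq> {v, b}" "{{a, v}, {v, b}} \<subseteq> incident_edges G v"
    by (auto simp: path_Cons_Cons incident_edges_def doubleton_eq_iff)
  then have "2 \<le> degree G v"
    using card_mono[OF finite_incident_edges[OF assms(1)], of "{{a, v}, {v, b}}" v]
    by (simp add: degree_def)
  then show False using assms(4) by (simp add: leaves_def)
qed

section \<open>Colors at a vertex and along a walk\<close>

lemma interval_coloring_adjacent:
  assumes "simple_graph G" "interval_coloring G \<alpha>" "v \<in> verts G"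
    and "e \<in> incident_edges G v" "e' \<in> incident_edges G v"
  shows "\<alpha> e' \<le> \<alpha> e + (degree G v - 1)"
proof -
  obtain a b where ab: "\<alpha> ` incident_edges G v = {a..b}"
    using assms(2,3) unfolding interval_coloring_def by blast
  then have "\<alpha> e \<in> {a..b}" "\<alpha> e' \<in> {a..b}" using assms(4,5) by blast+
  \<comment> \<open>Every number in \<open>{a..b}\<close> is the color of some edge at
    \<open>v\<close>, so the interval is no longer than the degree.\<close>
  moreover have "card {a..b} \<le> degree G v"
    using card_image_le[OF finite_incident_edges[OF assms(1)], of \<alpha> v] ab by (simp add: degree_def)
  ultimately show ?thesis unfolding atLeastAtMost_iff card_atLeastAtMost by linarith
qed

text \<open>Each inner vertex of the walk costs one adjacent step; \<open>p\<close> lists only these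
  inner vertices, so the degrees of \<open>x\<close> and \<open>y\<close> do not enter. Stating it
  for walks allows \<open>x = y\<close>, which is how it is applied with both ends at the
  apex.\<close>

lemma interval_coloring_walk:
  assumes "simple_graph G" "interval_coloring G \<alpha>" "walk G (x # p @ [y])" "p \<noteq> []"
  shows "\<alpha> {last p, y} \<le> \<alpha> {x, hd p} + (\<Sum>v\<leftarrow>p. degree G v - 1)"
  using assms(4,3)
proof (induction p arbitrary: x rule: list_nonempty_induct)
  case (single v)
  then show ?case
    using interval_coloring_adjacent[OF assms(1,2), of v "{x, v}" "{v, y}"]
    by (simp add: walk_Cons_Cons incident_edges_def)
next
  case (cons v p)
  then obtain w q where p: "p = w # q" by (cases p) auto
  have "\<alpha> {v, w} \<le> \<alpha> {x, v} + (degree G v - 1)"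
    using interval_coloring_adjacent[OF assms(1,2), of v "{x, v}" "{v, w}"] cons(3)
    by (simp add: walk_Cons_Cons incident_edges_def p)
  moreover have "\<alpha> {last p, y} \<le> \<alpha> {v, w} + (\<Sum>v\<leftarrow>p. degree G v - 1)"
    using cons by (simp add: walk_Cons_Cons p)
  ultimately show ?case using cons(1) by simp
qed

text \<open>The edges at \<open>v\<close> split into color classes of size at most
  \<open>k\<close>.\<close>

lemma card_incident_edges_le:
  assumes "simple_graph G" "improper_edge_coloring k G \<alpha>" "v \<in> verts G"
  shows "card (incident_edges G v) \<le> k * card (\<alpha> ` incident_edges G v)"
proof -
  let ?I = "incident_edges G v"
  have "card ?I = card (\<Union>c\<in>\<alpha> ` ?I. {e \<in> ?I. \<alpha> e = c})"
    by (rule arg_cong[of _ _ card]) blast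
  also have "\<dots> \<le> (\<Sum>c\<in>\<alpha> ` ?I. card {e \<in> ?I. \<alpha> e = c})"
    by (rule card_UN_le) (simp add: finite_incident_edges[OF assms(1)])
  also have "\<dots> \<le> card (\<alpha> ` ?I) * k"
    using sum_bounded_above[of "\<alpha> ` ?I" "\<lambda>c. card {e \<in> ?I. \<alpha> e = c}" k] assms(2,3)
    by (simp add: improper_edge_coloring_def)
  finally show ?thesis by (simp add: mult.commute)
qed

section \<open>The cone over the leaves and the colors at its apex\<close>

lemma incident_edges_leaf_cone_None:
  "incident_edges (leaf_cone T) None = (\<lambda>v. {None, Some v}) ` leaves T"
  unfolding incident_edges_def leaf_cone_def by auto

lemma degree_leaf_cone_le:
  assumes "simple_graph T"
  shows "degree (leaf_cone T) (Some v) - 1 \<le> degree T v - 1 + of_bool (v \<in> leaves T)"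
proof -
  let ?A = "if v \<in> leaves T then {{None, Some v}} else {}"
  have "incident_edges (leaf_cone T) (Some v) \<subseteq> (`) Some ` incident_edges T v \<union> ?A"
    unfolding incident_edges_def leaf_cone_def by auto
  then have "degree (leaf_cone T) (Some v) \<le> card ((`) Some ` incident_edges T v \<union> ?A)"
    unfolding degree_def using finite_incident_edges[OF assms] by (intro card_mono) auto
  also have "\<dots> \<le> card ((`) Some ` incident_edges T v) + card ?A"
    by (rule card_Un_le)
  also have "\<dots> \<le> degree T v + card ?A"
    unfolding degree_def by (simp add: card_image_le finite_incident_edges[OF assms])
  finally have "degree (leaf_cone T) (Some v) \<le> degree T v + card ?A" .
  \<comment> \<open>At a leaf the tree degree is 1, so the bound reads
    \<open>2 - 1 \<le> 0 + 1\<close>; elsewhere no edge is added.\<close>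
  then show ?thesis by (cases "v \<in> leaves T") (auto simp: leaves_def)
qed

lemma walk_leaf_cone:
  assumes "walk T p" "hd p \<in> leaves T" "last p \<in> leaves T"
  shows "walk (leaf_cone T) (None # map Some p @ [None])"
proof -
  have edge: "{Some x, Some y} \<in> edges (leaf_cone T)" if "{x, y} \<in> edges T" for x y
    unfolding leaf_cone_def using imageI[OF that, of "(`) Some"] by simp
  have "walk (leaf_cone T) (map Some p)"
    using assms(1) unfolding walk_iff_successively successively_map
    by (auto simp: leaf_cone_def[THEN arg_cong[of _ _ verts]] elim!: successively_mono intro: edge)
  moreover have "walk (leaf_cone T) [None]"
    by (simp add: walk_def leaf_cone_def)
  moreover have "p \<noteq> []" using assms(1) by (simp add: walk_def)
  ultimately show ?thesis
    using assms(2,3) walk_append[of "[None]" "map Some p @ [None]" "leaf_cone T"]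
    by (auto simp: walk_append hd_map last_map hd_append leaf_cone_def insert_commute)
qed

text \<open>The minimum is attained, and a coloring that is \<open>mu_int G\<close>-improper is also
  \<open>k\<close>-improper for every larger \<open>k\<close>.\<close>

lemma mu_int_le_obtains:
  assumes "simple_graph G" "mu_int G \<le> k"
  obtains \<alpha> where "improper_edge_coloring k G \<alpha>" "interval_coloring G \<alpha>"
proof -
  have "\<exists>\<alpha>. improper_edge_coloring (mu_int G) G \<alpha> \<and> interval_coloring G \<alpha>"
    unfolding mu_int_def by (rule LeastI_ex) (rule ex_improper_interval_coloring[OF assms(1)])
  then show ?thesis
    using assms(2) that unfolding improper_edge_coloring_def by (meson le_trans)
qed

text \<open>The tree degrees along the joining path contribute at most
  \<open>path_max T - 1\<close>, and the apex edges at most 2, one for each leaf on the path. For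
  \<open>v = w\<close> the path may be a single vertex.\<close>

lemma leaf_cone_color_diff:
  assumes "tree T" "interval_coloring (leaf_cone T) \<alpha>" "v \<in> leaves T" "w \<in> leaves T"
  shows "\<alpha> {None, Some w} \<le> \<alpha> {None, Some v} + path_max T + 1"
proof -
  have T: "simple_graph T" "connected_graph T" "\<nexists>c. cycle T c"
    using assms(1) by (auto simp: tree_def)
  have "v \<in> verts T" "w \<in> verts T"
    using assms(3,4) by (auto simp: leaves_def)
  then obtain p where p: "path T p" "hd p = v" "last p = w"
    using T(2) unfolding connected_graph_def by (metis walk_imp_path)
  then have p': "walk T p" "p \<noteq> []" "distinct p"
    by (auto simp: path_def walk_def)
  have "\<alpha> {None, Some w} \<le> \<alpha> {None, Some v} + (\<Sum>x\<leftarrow>p. degree (leaf_cone T) (Some x) - 1)"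
    using interval_coloring_walk[OF simple_graph_leaf_cone[OF T(1)] assms(2) walk_leaf_cone[OF p'(1)]]
      assms(3,4) p(2,3) p'(2)
    by (simp add: hd_map last_map insert_commute comp_def)
  also have "(\<Sum>x\<leftarrow>p. degree (leaf_cone T) (Some x) - 1)
      = (\<Sum>x\<in>set p. degree (leaf_cone T) (Some x) - 1)"
    using p'(3) by (rule sum_list_distinct_conv_sum_set)
  also have "\<dots> \<le> (\<Sum>x\<in>set p. degree T x - 1 + of_bool (x \<in> leaves T))"
    by (intro sum_mono degree_leaf_cone_le T(1))
  also have "\<dots> = (\<Sum>x\<in>set p. degree T x - 1) + card (set p \<inter> leaves T)"
    by (simp add: sum.distrib Int_def)
  finally have "\<alpha> {None, Some w}
      \<le> \<alpha> {None, Some v} + ((\<Sum>x\<in>set p. degree T x - 1) + card (set p \<inter> leaves T))"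
    by simp
  moreover have "card (set p \<inter> leaves T) \<le> 2"
  proof -
    \<comment> \<open>Only the two ends of a path can be leaves, and they may coincide.\<close>
    have "card (set p \<inter> leaves T) \<le> card {v, w}"
      using leaf_on_path[OF T(1) p(1)] p by (intro card_mono) auto
    also have "\<dots> \<le> 2" by (simp add: card_insert_if)
    finally show ?thesis .
  qed
  moreover have "(\<Sum>x\<in>set p. degree T x - 1) < path_max T"
    using sum_degree_path[OF T(1,3) p(1)] card_incident_le_path_max[OF T(1,3) p(1)] assms(4) p(3)
    by (simp add: leaves_def)
  ultimately show ?thesis by linarith
qed

theorem theorem13:
  fixes k :: nat and T :: "'a ugraph"
  assumes "k > 0"
    and "tree T"
    and "card (leaves T) > k * (path_max T + 2)"
  shows "mu_int (leaf_cone T) > k"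
proof (rule ccontr)
  let ?G = "leaf_cone T"
  assume "\<not> mu_int ?G > k"
  moreover have G: "simple_graph ?G"
    using assms(2) by (simp add: tree_def simple_graph_leaf_cone)
  ultimately obtain \<alpha> where \<alpha>: "improper_edge_coloring k ?G \<alpha>" "interval_coloring ?G \<alpha>"
    by (meson mu_int_le_obtains not_less)
  have apex: "None \<in> verts ?G" by (simp add: leaf_cone_def)
  then obtain a b where ab: "\<alpha> ` incident_edges ?G None = {a..b}"
    using \<alpha>(2) unfolding interval_coloring_def by blast
  have "card (leaves T) = card (incident_edges ?G None)"
    unfolding incident_edges_leaf_cone_None
    by (rule card_image[symmetric]) (auto simp: inj_on_def doubleton_eq_iff)
  also have "\<dots> \<le> k * card {a..b}"
    using card_incident_edges_le[OF G \<alpha>(1) apex] ab by simp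
  finally have "k * (path_max T + 2) < k * card {a..b}"
    using assms(3) by linarith
  then have card: "path_max T + 2 < Suc b - a"
    unfolding mult_less_cancel1 by simp
  \<comment> \<open>The interval is nonempty, so both of its ends occur as colors at the
    apex.\<close>
  then have "a \<in> \<alpha> ` incident_edges ?G None" "b \<in> \<alpha> ` incident_edges ?G None"
    unfolding ab by auto
  then obtain v w where "v \<in> leaves T" "\<alpha> {None, Some v} = a" "w \<in> leaves T" "\<alpha> {None, Some w} = b"
    unfolding incident_edges_leaf_cone_None by blast
  \<comment> \<open>This leaves room for at most \<open>path_max T + 2\<close> colors, whereas
    \<open>card\<close> demands more.\<close>
  then have "b \<le> a + path_max T + 1"
    using leaf_cone_color_diff[OF assms(2) \<alpha>(2)] by blast
  with card show False by linarith
qed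

end
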